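(* Let $m\mathfrak H$ be the meta-Hahn algebra with parameters $\eta_0,\eta_1,\eta_3$ and Casimir element $Q$. A central extension of the rational Hahn algebra $r\mathfrak H$ is embedded in $m\mathfrak H$ by taking $X$, $Y=XV$, $Z$ as generators. The coefficients $\xi_0,\dots,\xi_4$ entering the relations of $r\mathfrak H$, $$[Z,X]=Z^2+Z,$$ $$[X,Y]=\xi_1(X^2+Z^2)+\{X,Z\}+\{Y,Z\}+\xi_2X+\xi_3Z+Y+\xi_0\mathcal I,$$ $$[Y,Z]=3X^2+Z^2+\xi_1\{X,Z\}+\xi_4X+\xi_2Z+\xi_0\mathcal I,$$ are given in terms of the parameters of $m\mathfrak H$ by $$\xi_0=\tfrac12(\eta_3-Q),\quad \xi_1=\eta_1+1,\quad \xi_2=\eta_0+\eta_3+1,\quad \xi_3=\eta_0+\eta_1+\eta_3+1,\quad \xi_4=2\eta_3+1.$$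
   Context: $[A,B]=AB-BA$, $\{A,B\}=AB+BA$. The rational Hahn algebra $r\mathfrak H$ is the algebra with three generators $X,Y,Z$ and the three displayed defining relations, with parameters $\xi_0,\dots,\xi_4$. The meta-Hahn algebra $m\mathfrak H$ with real parameters $\eta_0,\eta_1,\eta_3$ is the algebra generated by $X,Z,V$ with defining relations $$[Z,X]=Z^2+Z,\qquad [X,V]=\{V,Z\}+\eta_1X+V-\eta_1Z+\eta_0\mathcal I,\qquad [V,Z]=2X+\eta_1Z+\eta_3\mathcal I,$$ with $\mathcal I$ the identity (central). Its Casimir (central) element is $$Q=\{V,Z^2+Z\}+2X^2+(2-\eta_1)Z^2+\eta_1\{X,Z\}+2\eta_3X+2(\eta_0+1)Z.$$ "Central extension" refers to the fact that $\xi_0$ involves the central element $Q$ rather than being a number.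
   Formalization: "Embedded" is read as a homomorphism from the central extension (ξ₀ an added central generator) onto the subalgebra of mH generated by X, XV, Z; injectivity is not claimed, since it fails: a nonzero element X³+Y(Z²+Z)+…+ξ₀X is sent to 0. *)

theory Defs
  imports
    "HOL-Library.Poly_Mapping"
    "HOL-Algebra.QuotRing"
    "HOL-Algebra.Generated_Rings"
    "HOL-Algebra.Algebraic_Closure_Type"
begin

section \<open>Associative algebras presented by generators and relations\<close>

text \<open>
  Words are written additively so that finitely supported functions on them, with the
  convolution product of \<^theory>\<open>HOL-Library.Poly_Mapping\<close>, form the free unital
  associative algebra.
\<close>

datatype 'g free_word = Word "'g list"

instantiation free_word :: (type) monoid_add
begin

definition zero_free_word :: "'a free_word"
  where "0 = Word []"

fun plus_free_word :: "'a free_word \<Rightarrow> 'a free_word \<Rightarrow> 'a free_word"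
  where "Word u + Word v = Word (u @ v)"

instance
proof
  fix a b c :: "'a free_word"
  show "a + b + c = a + (b + c)"
    by (cases a; cases b; cases c) simp
  show "0 + a = a"
    by (cases a) (simp add: zero_free_word_def)
  show "a + 0 = a"
    by (cases a) (simp add: zero_free_word_def)
qed

end

type_synonym ('g, 'k) free_algebra = "'g free_word \<Rightarrow>\<^sub>0 'k"

definition fgen :: "'g \<Rightarrow> ('g, 'k::field) free_algebra"
  where "fgen g = Poly_Mapping.single (Word [g]) 1"

definition fscalar :: "'k \<Rightarrow> ('g, 'k::field) free_algebra"
  where "fscalar c = Poly_Mapping.single 0 c"

text \<open>
  A relation \<open>l = r\<close> is a pair \<open>(l, r)\<close>; the ideals of \<^theory>\<open>HOL-Algebra.Ideal\<close> are two-sided.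
  The algebra structure over the field \<open>'k\<close> is carried by \<open>presented_scalar\<close>:
  \<open>c\<close> acts as multiplication by the class of \<open>c\<close> times the identity.
\<close>

definition relation_ideal ::
    "(('g, 'k::field) free_algebra \<times> ('g, 'k) free_algebra) set \<Rightarrow> ('g, 'k) free_algebra set"
  where "relation_ideal P = genideal ring_of_type_algebra {l - r | l r. (l, r) \<in> P}"

definition presented_algebra ::
    "(('g, 'k::field) free_algebra \<times> ('g, 'k) free_algebra) set \<Rightarrow> ('g, 'k) free_algebra set ring"
  where "presented_algebra P = ring_of_type_algebra Quot relation_ideal P"

definition presented_class ::
    "(('g, 'k::field) free_algebra \<times> ('g, 'k) free_algebra) set \<Rightarrow>
      ('g, 'k) free_algebra \<Rightarrow> ('g, 'k) free_algebra set"
  where "presented_class P a = relation_ideal P +>\<^bsub>ring_of_type_algebra\<^esub> a"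

definition presented_gen ::
    "(('g, 'k::field) free_algebra \<times> ('g, 'k) free_algebra) set \<Rightarrow>
      'g \<Rightarrow> ('g, 'k) free_algebra set"
  where "presented_gen P g = presented_class P (fgen g)"

definition presented_scalar ::
    "(('g, 'k::field) free_algebra \<times> ('g, 'k) free_algebra) set \<Rightarrow>
      'k \<Rightarrow> ('g, 'k) free_algebra set"
  where "presented_scalar P c = presented_class P (fscalar c)"

definition comm :: "'a::ring \<Rightarrow> 'a \<Rightarrow> 'a"
  where "comm a b = a * b - b * a"

definition acomm :: "'a::ring \<Rightarrow> 'a \<Rightarrow> 'a"
  where "acomm a b = a * b + b * a"

definition ring_comm :: "('a, 'b) ring_scheme \<Rightarrow> 'a \<Rightarrow> 'a \<Rightarrow> 'a"
  where "ring_comm R a b = (a \<otimes>\<^bsub>R\<^esub> b) \<ominus>\<^bsub>R\<^esub> (b \<otimes>\<^bsub>R\<^esub> a)"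

definition ring_acomm :: "('a, 'b) ring_scheme \<Rightarrow> 'a \<Rightarrow> 'a \<Rightarrow> 'a"
  where "ring_acomm R a b = (a \<otimes>\<^bsub>R\<^esub> b) \<oplus>\<^bsub>R\<^esub> (b \<otimes>\<^bsub>R\<^esub> a)"


section \<open>The meta-Hahn algebra\<close>

datatype mH_gen = mX | mV | mZ

definition meta_hahn_relations ::
    "'k::field \<Rightarrow> 'k \<Rightarrow> 'k \<Rightarrow> ((mH_gen, 'k) free_algebra \<times> (mH_gen, 'k) free_algebra) set"
  where "meta_hahn_relations \<eta>0 \<eta>1 \<eta>3 =
    (let x = fgen mX; v = fgen mV; z = fgen mZ in
     {(comm z x, z^2 + z),
      (comm x v, acomm v z + fscalar \<eta>1 * x + v - fscalar \<eta>1 * z + fscalar \<eta>0),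
      (comm v z, 2 * x + fscalar \<eta>1 * z + fscalar \<eta>3)})"

definition meta_hahn :: "'k::field \<Rightarrow> 'k \<Rightarrow> 'k \<Rightarrow> (mH_gen, 'k) free_algebra set ring"
  where "meta_hahn \<eta>0 \<eta>1 \<eta>3 = presented_algebra (meta_hahn_relations \<eta>0 \<eta>1 \<eta>3)"

definition meta_hahn_casimir :: "'k::field \<Rightarrow> 'k \<Rightarrow> 'k \<Rightarrow> (mH_gen, 'k) free_algebra set"
  where "meta_hahn_casimir \<eta>0 \<eta>1 \<eta>3 = presented_class (meta_hahn_relations \<eta>0 \<eta>1 \<eta>3)
    (let x = fgen mX; v = fgen mV; z = fgen mZ in
     acomm v (z^2 + z) + 2 * x^2 + fscalar (2 - \<eta>1) * z^2 + fscalar \<eta>1 * acomm x z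
       + fscalar (2 * \<eta>3) * x + fscalar (2 * (\<eta>0 + 1)) * z)"


section \<open>The rational Hahn algebra with central \<open>\<xi>\<^sub>0\<close>\<close>

text \<open>
  The central extension has the defining relations of the rational Hahn algebra,
  with the number \<open>\<xi>\<^sub>0\<close> replaced by an additional generator \<open>r\<Xi>\<close> which commutes with the
  other ones; the remaining coefficients stay numbers.
\<close>

datatype rH_gen = rX | rY | rZ | r\<Xi>

definition rational_hahn_ext_relations ::
    "'k::field \<Rightarrow> 'k \<Rightarrow> 'k \<Rightarrow> 'k \<Rightarrow> ((rH_gen, 'k) free_algebra \<times> (rH_gen, 'k) free_algebra) set"
  where "rational_hahn_ext_relations \<xi>1 \<xi>2 \<xi>3 \<xi>4 =
    (let x = fgen rX; y = fgen rY; z = fgen rZ; \<xi>0 = fgen r\<Xi> in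
     {(comm z x, z^2 + z),
      (comm x y, fscalar \<xi>1 * (x^2 + z^2) + acomm x z + acomm y z
         + fscalar \<xi>2 * x + fscalar \<xi>3 * z + y + \<xi>0),
      (comm y z, 3 * x^2 + z^2 + fscalar \<xi>1 * acomm x z
         + fscalar \<xi>4 * x + fscalar \<xi>2 * z + \<xi>0),
      (comm \<xi>0 x, 0), (comm \<xi>0 y, 0), (comm \<xi>0 z, 0)})"

definition rational_hahn_ext ::
    "'k::field \<Rightarrow> 'k \<Rightarrow> 'k \<Rightarrow> 'k \<Rightarrow> (rH_gen, 'k) free_algebra set ring"
  where "rational_hahn_ext \<xi>1 \<xi>2 \<xi>3 \<xi>4 =
    presented_algebra (rational_hahn_ext_relations \<xi>1 \<xi>2 \<xi>3 \<xi>4)"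

end

theory Submission
  imports Defs
begin

text \<open>
  All identities in the meta-Hahn algebra are memberships in its relation ideal, and each is
  witnessed by writing the element explicitly as a combination of the three relators.
  Since \<open>\<xi>\<^sub>0\<close> carries the factor \<open>1/2\<close>, the relations for \<open>[X, Y]\<close> and \<open>[Y, Z]\<close> are first shown
  doubled. Substituting \<open>X\<close>, \<open>X V\<close>, \<open>Z\<close>, \<open>(\<eta>\<^sub>3 - Q)/2\<close> for the generators then maps the relation
  ideal of the extended rational Hahn algebra into that of the meta-Hahn algebra, which gives the
  homomorphism.
\<close>

section \<open>The quotient map onto a presented algebra\<close>

lemma ring_of_type_algebra_simps [simp]:
  "carrier ring_of_type_algebra = UNIV"
  "a \<otimes>\<^bsub>ring_of_type_algebra\<^esub> b = a * b"
  "a \<oplus>\<^bsub>ring_of_type_algebra\<^esub> b = a + b"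
  "\<one>\<^bsub>ring_of_type_algebra\<^esub> = 1"
  "\<zero>\<^bsub>ring_of_type_algebra\<^esub> = 0"
  by (simp_all add: ring_of_type_algebra_def)

lemma ring_ring_of_type_algebra: "ring (ring_of_type_algebra :: 'a::ring_1 ring)"
proof -
  have "\<exists>y. x + y = 0" for x :: 'a
    using add.right_inverse by blast
  then show ?thesis
    unfolding ring_of_type_algebra_def using add.right_inverse
    by unfold_locales (auto simp: algebra_simps Units_def)
qed

lemma a_inv_ring_of_type_algebra [simp]:
  "\<ominus>\<^bsub>ring_of_type_algebra\<^esub> (a :: 'a::ring_1) = - a"
proof -
  interpret ring "ring_of_type_algebra :: 'a ring" by (rule ring_ring_of_type_algebra)
  show ?thesis by (rule minus_equality) simp_all
qed

lemma ideal_relation_ideal: "ideal (relation_ideal P) ring_of_type_algebra"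
  unfolding relation_ideal_def by (rule ring.genideal_ideal[OF ring_ring_of_type_algebra]) simp

lemma relator_in_relation_ideal: "(l, r) \<in> P \<Longrightarrow> l - r \<in> relation_ideal P"
  unfolding relation_ideal_def
  using ring.genideal_self[OF ring_ring_of_type_algebra, of "{l - r |l r. (l, r) \<in> P}"] by auto

lemma relation_ideal_least:
  "ideal J ring_of_type_algebra \<Longrightarrow> (\<And>l r. (l, r) \<in> P \<Longrightarrow> l - r \<in> J) \<Longrightarrow> relation_ideal P \<subseteq> J"
  unfolding relation_ideal_def by (rule ring.genideal_minimal[OF ring_ring_of_type_algebra]) auto

lemma relation_ideal_add: "a \<in> relation_ideal P \<Longrightarrow> b \<in> relation_ideal P \<Longrightarrow> a + b \<in> relation_ideal P"
  using additive_subgroup.a_closed[OF ideal.axioms(1)[OF ideal_relation_ideal]] by fastforce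

lemma relation_ideal_mult_left: "a \<in> relation_ideal P \<Longrightarrow> b * a \<in> relation_ideal P"
  using ideal.I_l_closed[OF ideal_relation_ideal] by fastforce

lemma relation_ideal_mult_right: "a \<in> relation_ideal P \<Longrightarrow> a * b \<in> relation_ideal P"
  using ideal.I_r_closed[OF ideal_relation_ideal] by fastforce

lemma relation_ideal_zero: "0 \<in> relation_ideal P"
  using additive_subgroup.zero_closed[OF ideal.axioms(1)[OF ideal_relation_ideal]] by fastforce

lemma relation_ideal_diff: "a \<in> relation_ideal P \<Longrightarrow> b \<in> relation_ideal P \<Longrightarrow> a - b \<in> relation_ideal P"
  using relation_ideal_add[of a P "-1 * b"] relation_ideal_mult_left[of b P "-1"] by simp

text \<open>These serve as conditional rewrite rules. A product is accepted once either factor lies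
  in the ideal, so any explicit two-sided combination of relators is recognised by simplification
  alone.\<close>

lemmas relation_ideal_closed =
  relation_ideal_add relation_ideal_diff relation_ideal_mult_left relation_ideal_mult_right

lemma presented_class_hom:
  "ring_hom_ring ring_of_type_algebra (presented_algebra P) (presented_class P)"
proof -
  have "presented_class P = (+>\<^bsub>ring_of_type_algebra\<^esub>) (relation_ideal P)"
    by (auto simp: presented_class_def)
  then show ?thesis
    unfolding presented_algebra_def by (simp add: ideal.rcos_ring_hom_ring[OF ideal_relation_ideal])
qed

lemma carrier_presented_algebra: "carrier (presented_algebra P) = range (presented_class P)"
  by (auto simp: presented_algebra_def presented_class_def FactRing_def A_RCOSETS_def')

text \<open>Gathers an expression in the quotient into a single class, so that by
  \<open>presented_class_eq_iff\<close> an equation there becomes an ideal membership in the free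
  algebra.\<close>

lemma presented_class_simps:
  "presented_class P a \<otimes>\<^bsub>presented_algebra P\<^esub> presented_class P b = presented_class P (a * b)"
  "presented_class P a \<oplus>\<^bsub>presented_algebra P\<^esub> presented_class P b = presented_class P (a + b)"
  "\<ominus>\<^bsub>presented_algebra P\<^esub> presented_class P a = presented_class P (- a)"
  "presented_class P a \<ominus>\<^bsub>presented_algebra P\<^esub> presented_class P b = presented_class P (a - b)"
  "\<one>\<^bsub>presented_algebra P\<^esub> = presented_class P 1"
proof -
  interpret h: ring_hom_ring ring_of_type_algebra "presented_algebra P" "presented_class P"
    by (rule presented_class_hom)
  show "presented_class P a \<otimes>\<^bsub>presented_algebra P\<^esub> presented_class P b = presented_class P (a * b)"
    using h.hom_mult[of a b] by simp
  show add: "presented_class P a \<oplus>\<^bsub>presented_algebra P\<^esub> presented_class P b = presented_class P (a + b)" for b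
    using h.hom_add[of a b] by simp
  show inv: "\<ominus>\<^bsub>presented_algebra P\<^esub> presented_class P a = presented_class P (- a)" for a
    using h.hom_a_inv[of a] by simp
  show "presented_class P a \<ominus>\<^bsub>presented_algebra P\<^esub> presented_class P b = presented_class P (a - b)"
    by (simp add: a_minus_def inv add)
  show "\<one>\<^bsub>presented_algebra P\<^esub> = presented_class P 1"
    using h.hom_one by simp
qed

lemma presented_class_eq_iff:
  "presented_class P a = presented_class P b \<longleftrightarrow> a - b \<in> relation_ideal P"
proof -
  interpret ideal "relation_ideal P" ring_of_type_algebra by (rule ideal_relation_ideal)
  show ?thesis
    using quotient_eq_iff_same_a_r_cos[OF ideal_relation_ideal, of a b]
    by (simp add: presented_class_def a_minus_def)
qed

lemma ring_comm_presented_class: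
  "ring_comm (presented_algebra P) (presented_class P a) (presented_class P b) = presented_class P (comm a b)"
  by (simp add: ring_comm_def comm_def presented_class_simps)

lemma ring_acomm_presented_class:
  "ring_acomm (presented_algebra P) (presented_class P a) (presented_class P b) = presented_class P (acomm a b)"
  by (simp add: ring_acomm_def acomm_def presented_class_simps)


section \<open>Substitution in free algebras\<close>

lemma fscalar_simps:
  "fscalar (a + b) = fscalar a + fscalar b"
  "fscalar (a - b) = fscalar a - fscalar b"
  "fscalar (a * b) = fscalar a * fscalar b"
  "fscalar 1 = 1"
  "fscalar 0 = 0"
  "fscalar (numeral n) = numeral n"
  by (simp_all add: fscalar_def single_add single_diff mult_single)

lemma free_algebra_additive_induct [case_names single add]:
  assumes "\<And>w c. Q (Poly_Mapping.single w c)" and "\<And>a b. Q a \<Longrightarrow> Q b \<Longrightarrow> Q (a + b)"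
  shows "Q (a :: ('g, 'k::field) free_algebra)"
proof (induction a rule: update_induct)
  case const
  show ?case using assms(1)[of _ 0] by simp
next
  case (update a w c)
  \<comment> \<open>The induction only updates at a word \<open>w\<close> outside the support of
    \<open>a\<close>, so nothing is overwritten.\<close>
  then have "Poly_Mapping.update w c a = a + Poly_Mapping.single w c"
    by (intro poly_mapping_eqI)
      (auto simp: lookup_update lookup_add lookup_single in_keys_iff when_def)
  then show ?case using update assms by simp
qed

text \<open>A scalar sits at the empty word, which is neutral on both sides, and coefficients in a
  field commute.\<close>

lemma fscalar_central: "a * fscalar c = fscalar c * a"
  by (induction a rule: free_algebra_additive_induct)
    (simp_all add: fscalar_def mult_single algebra_simps)

lemma single_Word_Cons:
  "Poly_Mapping.single (Word (g # u)) c = fgen g * Poly_Mapping.single (Word u) c"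
  by (simp add: fgen_def mult_single)

text \<open>A monomial loses its letters one by one from the left until only its coefficient at the
  empty word is left, which is an \<open>fscalar\<close>.\<close>

lemma free_algebra_induct [case_names fscalar fgen add mult]:
  assumes fscalar: "\<And>c. Q (fscalar c)" and fgen: "\<And>g. Q (fgen g)"
    and add: "\<And>a b. Q a \<Longrightarrow> Q b \<Longrightarrow> Q (a + b)"
    and mult: "\<And>a b. Q a \<Longrightarrow> Q b \<Longrightarrow> Q (a * b)"
  shows "Q (a :: ('g, 'k::field) free_algebra)"
proof (induction a rule: free_algebra_additive_induct)
  case (single w c)
  have "Q (Poly_Mapping.single (Word u) c)" for u
  proof (induction u)
    case Nil
    show ?case using fscalar[of c] by (simp add: fscalar_def zero_free_word_def)
  next
    case (Cons g u)
    then show ?case by (simp add: single_Word_Cons fgen mult)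
  qed
  then show ?case by (cases w) simp
qed (rule add)

fun word_subst :: "('g \<Rightarrow> ('h, 'k::field) free_algebra) \<Rightarrow> 'g free_word \<Rightarrow> ('h, 'k) free_algebra"
  where "word_subst f (Word u) = prod_list (map f u)"

lemma word_subst_add: "word_subst f (u + w) = word_subst f u * word_subst f w"
  by (cases u; cases w) simp

text \<open>The evaluation homomorphism of the free algebra at the images \<open>f\<close> of the
  generators.\<close>

definition free_subst ::
    "('g \<Rightarrow> ('h, 'k::field) free_algebra) \<Rightarrow> ('g, 'k) free_algebra \<Rightarrow> ('h, 'k) free_algebra"
  where "free_subst f a = (\<Sum>w\<in>Poly_Mapping.keys a. fscalar (Poly_Mapping.lookup a w) * word_subst f w)"

text \<open>Cancellation can shrink the support of a sum, so additivity requires summing over a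
  common larger index set.\<close>

lemma free_subst_superset:
  assumes "finite S" "Poly_Mapping.keys a \<subseteq> S"
  shows "free_subst f a = (\<Sum>w\<in>S. fscalar (Poly_Mapping.lookup a w) * word_subst f w)"
  unfolding free_subst_def
  by (rule sum.mono_neutral_left[OF assms]) (auto simp: in_keys_iff fscalar_simps)

lemma free_subst_add: "free_subst f (a + b) = free_subst f a + free_subst f b"
proof -
  have "Poly_Mapping.keys (a + b) \<subseteq> Poly_Mapping.keys a \<union> Poly_Mapping.keys b" by (rule Poly_Mapping.keys_add)
  then show ?thesis
    by (simp add: free_subst_superset[of "Poly_Mapping.keys a \<union> Poly_Mapping.keys b"] lookup_add fscalar_simps
        distrib_right sum.distrib)
qed

lemma free_subst_single: "free_subst f (Poly_Mapping.single w c) = fscalar c * word_subst f w"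
  by (simp add: free_subst_superset[of "{w}"])

lemma free_subst_fscalar: "free_subst f (fscalar c) = fscalar c"
proof -
  have "word_subst f 0 = 1" by (simp add: zero_free_word_def)
  then show ?thesis using free_subst_single[of f 0 c] by (simp add: fscalar_def)
qed

lemma free_subst_fgen: "free_subst f (fgen g) = f g"
  by (simp add: fgen_def free_subst_single fscalar_simps)

lemma free_subst_mult: "free_subst f (a * b) = free_subst f a * free_subst f b"
proof (induction a rule: free_algebra_additive_induct)
  case (single u c)
  show ?case
  proof (induction b rule: free_algebra_additive_induct)
    case (single w d)
    \<comment> \<open>On monomials the only obstacle is the right coefficient, which has to pass the
      image of the left word.\<close>
    have "word_subst f u * fscalar d = fscalar d * word_subst f u" by (rule fscalar_central)
    then show ?case
      by (simp add: mult_single free_subst_single word_subst_add fscalar_simps mult.assoc)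
        (metis mult.assoc)
  qed (simp add: free_subst_add distrib_left)
qed (simp add: free_subst_add distrib_right)

lemma free_subst_numeral: "free_subst f (numeral n) = numeral n"
  using free_subst_fscalar[of f "numeral n"] by (simp add: fscalar_simps)

lemma free_subst_one: "free_subst f 1 = 1"
  using free_subst_fscalar[of f 1] by (simp add: fscalar_simps)

lemma free_subst_zero: "free_subst f 0 = 0"
  by (simp add: free_subst_def)

lemma free_subst_diff: "free_subst f (a - b) = free_subst f a - free_subst f b"
  using free_subst_add[of f "a - b" b] by simp

lemma free_subst_uminus: "free_subst f (- a) = - free_subst f a"
  using free_subst_diff[of f 0 a] by (simp add: free_subst_zero)

lemmas free_subst_simps = free_subst_add free_subst_diff free_subst_mult free_subst_fscalar
  free_subst_fgen free_subst_numeral free_subst_one free_subst_zero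

text \<open>The preimage of \<open>relation_ideal P\<close> under the substitution is a two-sided
  ideal. If it contains the relators of \<open>R\<close>, then it contains the ideal they generate,
  and the substitution descends to classes.\<close>

lemma presented_algebra_universal:
  fixes f :: "'g \<Rightarrow> ('h, 'k::field) free_algebra"
  assumes "\<And>l r. (l, r) \<in> R \<Longrightarrow> free_subst f (l - r) \<in> relation_ideal P"
  obtains \<phi> where "\<phi> \<in> ring_hom (presented_algebra R) (presented_algebra P)"
    and "\<And>a. \<phi> (presented_class R a) = presented_class P (free_subst f a)"
proof -
  define J where "J = {a. free_subst f a \<in> relation_ideal P}"
  have "ideal J ring_of_type_algebra"
  proof (rule idealI[OF ring_ring_of_type_algebra])
    have ineg: "- a \<in> relation_ideal P" if "a \<in> relation_ideal P" for a
      using relation_ideal_diff[OF relation_ideal_zero that] by simp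
    interpret ring "ring_of_type_algebra :: ('g, 'k) free_algebra ring"
      by (rule ring_ring_of_type_algebra)
    show "subgroup J (add_monoid (ring_of_type_algebra :: ('g, 'k) free_algebra ring))"
      by (rule add.subgroupI)
        (auto simp: J_def free_subst_add relation_ideal_add free_subst_uminus ineg a_inv_def[symmetric]
          intro!: exI[of _ 0] simp: free_subst_zero relation_ideal_zero)
  qed (auto simp: J_def free_subst_mult relation_ideal_closed)
  then have "relation_ideal R \<subseteq> J"
    by (rule relation_ideal_least) (use assms in \<open>auto simp: J_def\<close>)
  then have wd: "presented_class P (free_subst f a) = presented_class P (free_subst f b)"
    if "presented_class R a = presented_class R b" for a b
    using that by (auto simp: presented_class_eq_iff J_def free_subst_diff)
  \<comment> \<open>By \<open>wd\<close> the chosen representative does not matter. Values at sets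
    that are not classes are arbitrary, as they lie outside the carrier.\<close>
  define \<phi> where "\<phi> C = presented_class P (free_subst f (SOME a. presented_class R a = C))" for C
  have \<phi>: "\<phi> (presented_class R a) = presented_class P (free_subst f a)" for a
    unfolding \<phi>_def by (rule wd) (rule someI[of _ a], simp)
  have "\<phi> \<in> ring_hom (presented_algebra R) (presented_algebra P)"
    by (rule ring_hom_memI)
      (auto simp: carrier_presented_algebra presented_class_simps \<phi> free_subst_simps)
  with \<phi> show thesis by (rule that[rotated])
qed


section \<open>Consequences of the meta-Hahn relations\<close>

text \<open>
  With \<open>r1\<close>, \<open>r2\<close>, \<open>r3\<close> the differences of the two sides of the meta-Hahn relations, the right-hand
  sides below record the steps of rewriting the left-hand sides to \<open>0\<close> with the rules
  \<open>x z \<rightarrow> z x - \<dots>\<close>, \<open>v x \<rightarrow> x v - \<dots>\<close> and \<open>v z \<rightarrow> z v + \<dots>\<close>.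
\<close>

context
  fixes x v z e0 e1 e3 r1 r2 r3 Q :: "'a::ring_1"
  assumes central: "\<And>a. a * e0 = e0 * a" "\<And>a. a * e1 = e1 * a" "\<And>a. a * e3 = e3 * a"
    and r1: "r1 = comm z x - (z^2 + z)"
    and r2: "r2 = comm x v - (acomm v z + e1 * x + v - e1 * z + e0)"
    and r3: "r3 = comm v z - (2 * x + e1 * z + e3)"
    and Q: "Q = acomm v (z^2 + z) + 2 * x^2 + (2 - e1) * z^2 + e1 * acomm x z
      + 2 * e3 * x + 2 * (e0 + 1) * z"
begin

lemma commute_left:
  "a * (e0 * b) = e0 * (a * b)" "a * (e1 * b) = e1 * (a * b)" "a * (e3 * b) = e3 * (a * b)"
  using central by (metis mult.assoc)+

text \<open>Expands to sums of monomials with scalars on the left, ordered \<open>e0\<close>,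
  \<open>e1\<close>, \<open>e3\<close>. Centrality is instantiated at particular factors because the
  general rules would swap two scalars back and forth.\<close>

lemmas normalize =
  comm_def acomm_def power2_eq_square mult_2 mult_2_right algebra_simps
  central[of x] central[of v] central[of z] commute_left[of x] commute_left[of v] commute_left[of z]
  central(1)[of e1] central(1)[of e3] central(2)[of e3]
  commute_left(1)[of e1] commute_left(1)[of e3] commute_left(2)[of e3]

lemma comm_casimir_x:
  "comm Q x = r3 * z * x + r1 * v * z + r1 * z * v + z * r3 * x + r3 * x
      - x * r3 * z - z * x * r3 - z * z * r3 - x * r3 - z * r3
      + 2 * (z * r1 * v + x * r1 + r1 * v - z * z * r2 - z * r2)
      + e1 * (x * r1 + r1 * x - r1 * z) + e3 * r1 + 2 * e0 * r1"
  unfolding Q r1 r2 r3 by (simp add: normalize)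

lemma comm_casimir_v:
  "comm Q v = 2 * (r2 * x + r2 * z + r3 * x + x * r2 - x * r3 - z * r2)
      - (v * r3 * z + r3 * v * z + z * v * r3 + z * r3 * v + v * r3 + r3 * v)
      + e1 * (r2 * z + r3 * z + z * r2 + z * r3 - r3 * x - x * r3)
      + 2 * e3 * r2 - 2 * e0 * r3"
  unfolding Q r1 r2 r3 by (simp add: normalize)

lemma comm_casimir_z:
  "comm Q z = r3 * z * z + z * z * r3 + r3 * z + z * r3
      - 2 * (x * r1 + r1 * x) - e1 * (r1 * z + z * r1) - 2 * e3 * r1"
  unfolding Q r1 r2 r3 by (simp add: normalize)

text \<open>Since \<open>comm x (x * v) = x * comm x v\<close>, the main term is
  \<open>2 * (x * r2)\<close>; the other relators reorder products to match those of
  \<open>Q\<close>.\<close>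

lemma comm_x_xv:
  "2 * (comm x (x * v) - ((e1 + 1) * (x^2 + z^2) + acomm x z + acomm (x * v) z
        + (e0 + e3 + 1) * x + (e0 + e1 + e3 + 1) * z + x * v)) - (e3 - Q)
    = r3 * z + z * r3 + r3 + 2 * (x * r2 - r1 * v) + e1 * r1"
  unfolding Q r1 r2 r3 by (simp add: normalize)

text \<open>The Leibniz rule \<open>comm (x * v) z = x * comm v z + comm x z * v\<close> accounts
  for \<open>2 * (x * r3 - r1 * v)\<close>; the remaining terms again match
  \<open>Q\<close>.\<close>

lemma comm_xv_z:
  "2 * (comm (x * v) z - (3 * x^2 + z^2 + (e1 + 1) * acomm x z
        + (2 * e3 + 1) * x + (e0 + e3 + 1) * z)) - (e3 - Q)
    = r3 * z + z * r3 + r3 + 2 * (x * r3 - r1 * v) - e1 * r1"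
proof -
  \<comment> \<open>In the normal form multiples are repeated summands; \<open>normalize\<close>
    already does this for the factor 2.\<close>
  have "3 * a = a + a + a" for a :: 'a
    using distrib_right[of 2 1 a] by (simp add: mult_2)
  then show ?thesis unfolding Q r1 r2 r3 by (simp add: normalize)
qed

end

text \<open>The commutator with \<open>q\<close> is a derivation that vanishes on scalars, so
  centrality modulo the ideal can be tested on generators.\<close>

lemma comm_in_relation_ideal:
  assumes "\<And>g. comm q (fgen g) \<in> relation_ideal P"
  shows "comm q a \<in> relation_ideal P"
proof (induction a rule: free_algebra_induct)
  case (fscalar c)
  show ?case by (simp add: comm_def fscalar_central relation_ideal_zero)
next
  case (fgen g)
  show ?case by (rule assms)
next
  case (add a b)
  moreover have "comm q (a + b) = comm q a + comm q b" by (simp add: comm_def algebra_simps)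
  ultimately show ?case by (simp add: relation_ideal_add)
next
  case (mult a b)
  moreover have "comm q (a * b) = comm q a * b + a * comm q b" by (simp add: comm_def algebra_simps)
  ultimately show ?case by (simp add: relation_ideal_closed)
qed

text \<open>Returns from a doubled relation to the original one: away from characteristic 2,
  \<open>fscalar (1 / 2)\<close> is inverse to \<open>2\<close> in the free algebra.\<close>

lemma relation_ideal_halve:
  fixes a b c :: "('g, 'k::field) free_algebra"
  assumes "2 * (a - b) - c \<in> relation_ideal P" and "(2 :: 'k) \<noteq> 0"
  shows "a - (b + fscalar (1 / 2) * c) \<in> relation_ideal P"
proof -
  have "fscalar (1 / 2 * 2) = (1 :: ('g, 'k) free_algebra)"
    using assms(2) by (simp add: fscalar_simps)
  then have "fscalar (1 / 2) * 2 = (1 :: ('g, 'k) free_algebra)"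
    by (simp only: fscalar_simps)
  then have "fscalar (1 / 2) * (2 * (a - b)) = a - b"
    by (simp only: mult.assoc[symmetric] mult_1_left)
  then have "fscalar (1 / 2) * (2 * (a - b) - c) = a - (b + fscalar (1 / 2) * c)"
    by (simp only: right_diff_distrib[of _ "2 * (a - b)"] diff_diff_add)
  then show ?thesis using relation_ideal_mult_left[OF assms(1)] by metis
qed

section \<open>Centrality of the Casimir element and the rational Hahn relations modulo the
  ideal\<close>

context
  fixes \<eta>0 \<eta>1 \<eta>3 :: "'k::field"
    and P :: "((mH_gen, 'k) free_algebra \<times> (mH_gen, 'k) free_algebra) set"
    and x v z Q :: "(mH_gen, 'k) free_algebra"
  assumes P: "P = meta_hahn_relations \<eta>0 \<eta>1 \<eta>3"
    and x: "x = fgen mX" and v: "v = fgen mV" and z: "z = fgen mZ"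
    and Q: "Q = acomm v (z^2 + z) + 2 * x^2 + fscalar (2 - \<eta>1) * z^2 + fscalar \<eta>1 * acomm x z
       + fscalar (2 * \<eta>3) * x + fscalar (2 * (\<eta>0 + 1)) * z"
begin

lemma meta_hahn_relators:
  "comm z x - (z^2 + z) \<in> relation_ideal P"
  "comm x v - (acomm v z + fscalar \<eta>1 * x + v - fscalar \<eta>1 * z + fscalar \<eta>0) \<in> relation_ideal P"
  "comm v z - (2 * x + fscalar \<eta>1 * z + fscalar \<eta>3) \<in> relation_ideal P"
  by (rule relator_in_relation_ideal, simp add: P meta_hahn_relations_def x v z Let_def)+

text \<open>Splits the compound scalars to give the shape that the abstract identities expect, with
  \<open>e1 = fscalar \<eta>1\<close> and likewise for \<open>e0\<close>, \<open>e3\<close>.\<close>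

lemma Q': "Q = acomm v (z^2 + z) + 2 * x^2 + (2 - fscalar \<eta>1) * z^2 + fscalar \<eta>1 * acomm x z
      + 2 * fscalar \<eta>3 * x + 2 * (fscalar \<eta>0 + 1) * z"
  by (simp add: Q fscalar_simps)

lemmas fscalar_central_args =
  fscalar_central[where c = \<eta>0] fscalar_central[where c = \<eta>1] fscalar_central[where c = \<eta>3]

lemma comm_casimir: "comm Q a \<in> relation_ideal P"
proof (rule comm_in_relation_ideal)
  fix g
  show "comm Q (fgen g) \<in> relation_ideal P"
  proof (cases g)
    case mX
    show ?thesis
      \<comment> \<open>The three \<open>refl\<close> instantiate \<open>r1\<close>,
        \<open>r2\<close>, \<open>r3\<close> with the relators themselves.\<close>
      unfolding mX x[symmetric] comm_casimir_x[OF fscalar_central_args refl refl refl Q']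
      by (intro relation_ideal_add relation_ideal_diff)
        (simp_all only: relation_ideal_closed meta_hahn_relators)
  next
    case mV
    show ?thesis
      unfolding mV v[symmetric] comm_casimir_v[OF fscalar_central_args refl refl refl Q']
      by (intro relation_ideal_add relation_ideal_diff)
        (simp_all only: relation_ideal_closed meta_hahn_relators)
  next
    case mZ
    show ?thesis
      unfolding mZ z[symmetric] comm_casimir_z[OF fscalar_central_args refl refl refl Q']
      by (intro relation_ideal_add relation_ideal_diff)
        (simp_all only: relation_ideal_closed meta_hahn_relators)
  qed
qed

context
  assumes two: "(2 :: 'k) \<noteq> 0"
begin

lemma rational_hahn_xy:
  "comm x (x * v) - (fscalar (\<eta>1 + 1) * (x^2 + z^2) + acomm x z + acomm (x * v) z
      + fscalar (\<eta>0 + \<eta>3 + 1) * x + fscalar (\<eta>0 + \<eta>1 + \<eta>3 + 1) * z + x * v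
      + fscalar (1 / 2) * (fscalar \<eta>3 - Q)) \<in> relation_ideal P"
  by (rule relation_ideal_halve[OF _ two], unfold fscalar_simps
      comm_x_xv[OF fscalar_central_args refl refl refl Q'])
    (simp only: relation_ideal_closed meta_hahn_relators)

lemma rational_hahn_yz:
  "comm (x * v) z - (3 * x^2 + z^2 + fscalar (\<eta>1 + 1) * acomm x z
      + fscalar (2 * \<eta>3 + 1) * x + fscalar (\<eta>0 + \<eta>3 + 1) * z
      + fscalar (1 / 2) * (fscalar \<eta>3 - Q)) \<in> relation_ideal P"
  by (rule relation_ideal_halve[OF _ two], unfold fscalar_simps
      comm_xv_z[OF fscalar_central_args refl refl refl Q'])
    (simp only: relation_ideal_closed meta_hahn_relators)

lemma comm_xi0: "comm (fscalar (1 / 2) * (fscalar \<eta>3 - Q)) a \<in> relation_ideal P"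
proof -
  have "a * (fscalar (1 / 2) * (fscalar \<eta>3 - Q)) = fscalar (1 / 2) * (fscalar \<eta>3 * a - a * Q)"
    by (metis fscalar_central mult.assoc right_diff_distrib)
  \<comment> \<open>The sign is written as a difference from \<open>0\<close> so that the closure
    rules for the ideal apply.\<close>
  then have "comm (fscalar (1 / 2) * (fscalar \<eta>3 - Q)) a = fscalar (1 / 2) * (0 - comm Q a)"
    by (simp add: comm_def algebra_simps)
  then show ?thesis
    by (simp only: relation_ideal_closed relation_ideal_zero comm_casimir)
qed

section \<open>The substitution into the meta-Hahn algebra and its image\<close>

context
  fixes f :: "rH_gen \<Rightarrow> (mH_gen, 'k) free_algebra"
  assumes f: "f = case_rH_gen x (x * v) z (fscalar (1 / 2) * (fscalar \<eta>3 - Q))"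
begin

text \<open>Of the six relators, the first becomes a meta-Hahn relator, the next two are the halved
  identities, and the last three become commutators with the image of \<open>r\<Xi>\<close>.\<close>

lemma rational_hahn_subst_relator:
  assumes "(l, r) \<in> rational_hahn_ext_relations (\<eta>1 + 1) (\<eta>0 + \<eta>3 + 1) (\<eta>0 + \<eta>1 + \<eta>3 + 1) (2 * \<eta>3 + 1)"
  shows "free_subst f (l - r) \<in> relation_ideal P"
proof -
  let ?S = "free_subst f"
  have comm: "?S (comm a b) = comm (?S a) (?S b)" and acomm: "?S (acomm a b) = acomm (?S a) (?S b)"
    and sq: "?S (a^2) = (?S a)^2" for a b
    by (simp_all add: comm_def acomm_def power2_eq_square free_subst_simps)
  have gens: "?S (fgen rX) = x" "?S (fgen rY) = x * v" "?S (fgen rZ) = z"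
    "?S (fgen r\<Xi>) = fscalar (1 / 2) * (fscalar \<eta>3 - Q)"
    by (simp_all add: free_subst_fgen f)
  note subst = free_subst_add free_subst_diff free_subst_mult free_subst_fscalar free_subst_numeral
    free_subst_zero comm acomm sq gens diff_zero
  from assms show ?thesis
    unfolding rational_hahn_ext_relations_def Let_def insert_iff prod.inject empty_iff
    by (elim disjE conjE FalseE; hypsubst; unfold subst; intro comm_xi0 rational_hahn_xy rational_hahn_yz
        meta_hahn_relators; simp)
qed

text \<open>\<open>generate_ring\<close> yields only a subring; putting all scalars among the
  generators makes it the unital subalgebra generated by the three elements.\<close>

lemma range_rational_hahn_subst:
  "range (\<lambda>a. presented_class P (free_subst f a)) =
    generate_ring (presented_algebra P) (range (presented_scalar P) \<union>
      {presented_class P x, presented_class P (x * v), presented_class P z})"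
    (is "range ?F = generate_ring ?M ?H")
proof
  note mem = generate_ring.eng_add[where R = ?M, of "presented_class P _" _ "presented_class P _",
      unfolded presented_class_simps]
    generate_ring.eng_mult[where R = ?M, of "presented_class P _" _ "presented_class P _",
      unfolded presented_class_simps]
  \<comment> \<open>\<open>generate_ring\<close> is closed under negation and addition by
    definition; differences are derived from these.\<close>
  have mem_diff: "presented_class P (a - b) \<in> generate_ring ?M ?H"
    if "presented_class P a \<in> generate_ring ?M ?H" "presented_class P b \<in> generate_ring ?M ?H" for a b
    using mem(1)[OF that(1) generate_ring.a_inv[OF that(2), unfolded presented_class_simps]] by simp
  have scalar: "presented_class P (fscalar c) \<in> generate_ring ?M ?H" for c
    by (rule generate_ring.incl) (auto simp: presented_scalar_def)
  have gens: "presented_class P x \<in> generate_ring ?M ?H"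
    "presented_class P (x * v) \<in> generate_ring ?M ?H" "presented_class P z \<in> generate_ring ?M ?H"
    by (auto intro: generate_ring.incl)
  \<comment> \<open>The relation for \<open>[Y, Z]\<close> expresses \<open>\<xi>\<^sub>0\<close> through \<open>X\<close>, \<open>Y\<close> and \<open>Z\<close>.\<close>
  have "presented_class P (fscalar (1 / 2) * (fscalar \<eta>3 - Q)) =
    presented_class P (comm (x * v) z - (fscalar 3 * x^2 + z^2 + fscalar (\<eta>1 + 1) * acomm x z
      + fscalar (2 * \<eta>3 + 1) * x + fscalar (\<eta>0 + \<eta>3 + 1) * z))"
    using rational_hahn_yz
    by (intro presented_class_eq_iff[THEN iffD2, THEN sym])
      (simp only: fscalar_simps(6) diff_diff_add)
  \<comment> \<open>The coefficient 3 was written as \<open>fscalar 3\<close> so that it is covered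
    by the scalar generators.\<close>
  also have "\<dots> \<in> generate_ring ?M ?H"
    unfolding comm_def acomm_def power2_eq_square by (intro mem mem_diff scalar gens)
  finally have xi0: "presented_class P (fscalar (1 / 2) * (fscalar \<eta>3 - Q)) \<in> generate_ring ?M ?H" .
  have "?F a \<in> generate_ring ?M ?H" for a
  proof (induction a rule: free_algebra_induct)
    case (fgen g)
    show ?case
      by (cases g) (simp_all only: free_subst_fgen f rH_gen.case gens xi0)
  qed (simp_all only: free_subst_simps scalar mem)
  then show "range ?F \<subseteq> generate_ring ?M ?H" by blast
  show "generate_ring ?M ?H \<subseteq> range ?F"
  proof
    fix h assume "h \<in> generate_ring ?M ?H"
    then show "h \<in> range ?F"
    proof (induction rule: generate_ring.induct)
      case one
      show ?case by (rule range_eqI[of _ _ 1]) (simp add: free_subst_one presented_class_simps)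
    next
      case (incl h)
      moreover have "presented_scalar P c = ?F (fscalar c)" for c
        by (simp add: presented_scalar_def free_subst_fscalar)
      moreover have "presented_class P x = ?F (fgen rX)" "presented_class P (x * v) = ?F (fgen rY)"
        "presented_class P z = ?F (fgen rZ)"
        by (simp_all add: free_subst_fgen f)
      ultimately show ?case by blast
    next
      case (a_inv h)
      then obtain a where "h = ?F a" by blast
      then have "\<ominus>\<^bsub>?M\<^esub> h = ?F (- a)"
        by (simp only: presented_class_simps free_subst_uminus)
      then show ?case by blast
    next
      case (eng_add h1 h2)
      then obtain a b where "h1 = ?F a" "h2 = ?F b" by blast
      then have "h1 \<oplus>\<^bsub>?M\<^esub> h2 = ?F (a + b)" by (simp add: presented_class_simps free_subst_add)
      then show ?case by blast
    next
      case (eng_mult h1 h2)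
      then obtain a b where "h1 = ?F a" "h2 = ?F b" by blast
      then have "h1 \<otimes>\<^bsub>?M\<^esub> h2 = ?F (a * b)" by (simp add: presented_class_simps free_subst_mult)
      then show ?case by blast
    qed
  qed
qed

end

end

end

text \<open>The embedding is expressed by a homomorphism from the extension onto the subalgebra
  generated by the images of \<open>rX\<close>, \<open>rY\<close>, \<open>rZ\<close>; injectivity is
  not asserted. The base field may be any \<open>real_field\<close>, such as the reals or the
  complex numbers.\<close>

theorem proposition3p2:
  fixes h0 h1 h3 :: real
  shows "let
      \<eta>0 = (of_real h0 :: 'k::real_field); \<eta>1 = of_real h1; \<eta>3 = of_real h3;
      M = meta_hahn \<eta>0 \<eta>1 \<eta>3;
      P = meta_hahn_relations \<eta>0 \<eta>1 \<eta>3;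
      s = presented_scalar P;
      x = presented_gen P mX; v = presented_gen P mV; z = presented_gen P mZ;
      Q = meta_hahn_casimir \<eta>0 \<eta>1 \<eta>3;
      y = x \<otimes>\<^bsub>M\<^esub> v;
      \<xi>0 = s (1 / 2) \<otimes>\<^bsub>M\<^esub> (s \<eta>3 \<ominus>\<^bsub>M\<^esub> Q);
      \<xi>1 = \<eta>1 + 1;
      \<xi>2 = \<eta>0 + \<eta>3 + 1;
      \<xi>3 = \<eta>0 + \<eta>1 + \<eta>3 + 1;
      \<xi>4 = 2 * \<eta>3 + 1;
      E = rational_hahn_ext \<xi>1 \<xi>2 \<xi>3 \<xi>4;
      R = rational_hahn_ext_relations \<xi>1 \<xi>2 \<xi>3 \<xi>4
    in
      (\<forall>a\<in>carrier M. Q \<otimes>\<^bsub>M\<^esub> a = a \<otimes>\<^bsub>M\<^esub> Q) \<and>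
      ring_comm M z x = z \<otimes>\<^bsub>M\<^esub> z \<oplus>\<^bsub>M\<^esub> z \<and>
      ring_comm M x y =
        s \<xi>1 \<otimes>\<^bsub>M\<^esub> (x \<otimes>\<^bsub>M\<^esub> x \<oplus>\<^bsub>M\<^esub> z \<otimes>\<^bsub>M\<^esub> z) \<oplus>\<^bsub>M\<^esub> ring_acomm M x z \<oplus>\<^bsub>M\<^esub> ring_acomm M y z
          \<oplus>\<^bsub>M\<^esub> s \<xi>2 \<otimes>\<^bsub>M\<^esub> x \<oplus>\<^bsub>M\<^esub> s \<xi>3 \<otimes>\<^bsub>M\<^esub> z \<oplus>\<^bsub>M\<^esub> y \<oplus>\<^bsub>M\<^esub> \<xi>0 \<and>
      ring_comm M y z =
        s 3 \<otimes>\<^bsub>M\<^esub> (x \<otimes>\<^bsub>M\<^esub> x) \<oplus>\<^bsub>M\<^esub> z \<otimes>\<^bsub>M\<^esub> z \<oplus>\<^bsub>M\<^esub> s \<xi>1 \<otimes>\<^bsub>M\<^esub> ring_acomm M x z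
          \<oplus>\<^bsub>M\<^esub> s \<xi>4 \<otimes>\<^bsub>M\<^esub> x \<oplus>\<^bsub>M\<^esub> s \<xi>2 \<otimes>\<^bsub>M\<^esub> z \<oplus>\<^bsub>M\<^esub> \<xi>0 \<and>
      (\<exists>\<phi>\<in>ring_hom E M.
        (\<forall>c. \<phi> (presented_scalar R c) = s c) \<and>
        \<phi> (presented_gen R rX) = x \<and>
        \<phi> (presented_gen R rY) = y \<and>
        \<phi> (presented_gen R rZ) = z \<and>
        \<phi> (presented_gen R r\<Xi>) = \<xi>0 \<and>
        \<phi> ` carrier E = generate_ring M (range s \<union> {x, y, z}))"
proof -
  define \<eta>0 \<eta>1 \<eta>3 where "\<eta>0 = (of_real h0 :: 'k)" and "\<eta>1 = (of_real h1 :: 'k)" and "\<eta>3 = (of_real h3 :: 'k)"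
  define P where "P = meta_hahn_relations \<eta>0 \<eta>1 \<eta>3"
  define x v z :: "(mH_gen, 'k) free_algebra" where "x = fgen mX" and "v = fgen mV" and "z = fgen mZ"
  define Q where "Q = acomm v (z^2 + z) + 2 * x^2 + fscalar (2 - \<eta>1) * z^2 + fscalar \<eta>1 * acomm x z
       + fscalar (2 * \<eta>3) * x + fscalar (2 * (\<eta>0 + 1)) * z"
  define f where "f = case_rH_gen x (x * v) z (fscalar (1 / 2) * (fscalar \<eta>3 - Q))"
  define R where "R = rational_hahn_ext_relations (\<eta>1 + 1) (\<eta>0 + \<eta>3 + 1) (\<eta>0 + \<eta>1 + \<eta>3 + 1) (2 * \<eta>3 + 1)"
  note defs = P_def x_def v_def z_def Q_def
  have two: "(2 :: 'k) \<noteq> 0" by simp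
  obtain \<phi> where \<phi>: "\<phi> \<in> ring_hom (presented_algebra R) (presented_algebra P)"
    and \<phi>_class: "\<And>a. \<phi> (presented_class R a) = presented_class P (free_subst f a)"
    using presented_algebra_universal[OF rational_hahn_subst_relator[OF defs two f_def, folded R_def]]
    by blast
  have M: "meta_hahn \<eta>0 \<eta>1 \<eta>3 = presented_algebra P"
    by (simp add: meta_hahn_def P_def)
  have E: "rational_hahn_ext (\<eta>1 + 1) (\<eta>0 + \<eta>3 + 1) (\<eta>0 + \<eta>1 + \<eta>3 + 1) (2 * \<eta>3 + 1) = presented_algebra R"
    by (simp add: rational_hahn_ext_def R_def)
  have gens: "presented_gen P mX = presented_class P x" "presented_gen P mV = presented_class P v"
    "presented_gen P mZ = presented_class P z"
    by (simp_all add: presented_gen_def x_def v_def z_def)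
  have casimir: "meta_hahn_casimir \<eta>0 \<eta>1 \<eta>3 = presented_class P Q"
    by (simp add: meta_hahn_casimir_def P_def Q_def x_def v_def z_def Let_def)
  note class_rules = presented_scalar_def presented_class_simps ring_comm_presented_class
    ring_acomm_presented_class presented_class_eq_iff fscalar_simps(6)
  have xi0: "presented_scalar P (1 / 2) \<otimes>\<^bsub>presented_algebra P\<^esub>
      (presented_scalar P \<eta>3 \<ominus>\<^bsub>presented_algebra P\<^esub> presented_class P Q)
      = presented_class P (fscalar (1 / 2) * (fscalar \<eta>3 - Q))"
    by (simp only: presented_scalar_def presented_class_simps)
  have central: "presented_class P Q \<otimes>\<^bsub>presented_algebra P\<^esub> a = a \<otimes>\<^bsub>presented_algebra P\<^esub> presented_class P Q"
    if a: "a \<in> carrier (presented_algebra P)" for a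
  proof -
    obtain b where "a = presented_class P b" using a by (auto simp: carrier_presented_algebra)
    \<comment> \<open>Equality of the two products of classes is membership of
      \<open>comm Q b\<close> in the ideal.\<close>
    then show ?thesis
      using comm_casimir[OF defs, of b] by (simp only: class_rules comm_def)
  qed
  have image: "\<phi> ` carrier (presented_algebra R) = generate_ring (presented_algebra P)
      (range (presented_scalar P) \<union>
        {presented_class P x, presented_class P (x * v), presented_class P z})"
    unfolding range_rational_hahn_subst[OF defs two f_def, symmetric] carrier_presented_algebra
    by (simp add: image_image \<phi>_class)
  have \<phi>_scalar: "\<phi> (presented_scalar R c) = presented_scalar P c" for c
    by (simp add: presented_scalar_def \<phi>_class free_subst_fscalar)
  have \<phi>_gens: "\<phi> (presented_gen R rX) = presented_class P x"
    "\<phi> (presented_gen R rY) = presented_class P (x * v)"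
    "\<phi> (presented_gen R rZ) = presented_class P z"
    "\<phi> (presented_gen R r\<Xi>) = presented_class P (fscalar (1 / 2) * (fscalar \<eta>3 - Q))"
    by (simp_all add: presented_gen_def \<phi>_class free_subst_fgen f_def)
  note relations = meta_hahn_relators(1)[OF defs] rational_hahn_xy[OF defs two]
    rational_hahn_yz[OF defs two]
  \<comment> \<open>Once every term is a class of a polynomial, the relations are ideal memberships.
    Squares are unfolded in \<open>relations\<close> because the statement uses products such as
    \<open>z \<otimes> z\<close>.\<close>
  show ?thesis
    unfolding Let_def \<eta>0_def[symmetric] \<eta>1_def[symmetric] \<eta>3_def[symmetric] M E gens casimir
      P_def[symmetric] R_def[symmetric] xi0 presented_class_simps(1)[of P x v]
    by (intro conjI ballI bexI[of _ \<phi>] allI central image \<phi>_scalar \<phi>_gens \<phi>;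
        simp only: class_rules relations[unfolded power2_eq_square])
qed

end
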